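(* For any integer $k\ge 3$, any 1-intersecting $k$-touching contact system of strings $\mathcal{S}$ can be colored with $\left\lceil \tfrac43 k\right\rceil+6$ colors, i.e. the intersection graph $G(\mathcal{S})$ has a proper coloring with at most $\left\lceil \tfrac43 k\right\rceil+6$ colors.
   Context: A string is the image of a continuous injective function from $[0,1]$ to $\mathbb{R}^2$; its two ends are the images of $0$ and $1$, and its interior is the image of $(0,1)$. All sets of strings considered are finite. A contact system of strings is a set of strings whose interiors are pairwise disjoint; in other words, if a point $c$ common to several strings lies in the interior of a string $s$, then all the other strings containing $c$ end at $c$. A contact system is $k$-touching if every point of the plane is contained in at most $k$ of its strings. It is 1-intersecting if any two distinct strings intersect in at most one point. The intersection graph $G(\mathcal{S})$ has vertex set $\mathcal{S}$, two distinct strings being adjacent if and only if they have non-empty intersection. *)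

theory Defs
  imports "HOL-Analysis.Analysis"
begin

definition is_string :: "(real^2) set \<Rightarrow> bool" where
  "is_string s \<longleftrightarrow> (\<exists>g. arc g \<and> path_image g = s)"

text \<open>A string is a point set, not a parametrized curve. Its interior, the image of the open unit
  interval, is the same for all parametrizations (lemma \<open>string_interior_eq\<close> below), so taking
  the union over all of them is harmless.\<close>

definition string_interior :: "(real^2) set \<Rightarrow> (real^2) set" where
  "string_interior s = (\<Union>g \<in> {g. arc g \<and> path_image g = s}. g ` {0<..<1})"

lemma arc_interior_subset:
  fixes g h :: "real \<Rightarrow> real^2"
  assumes g: "arc g" and h: "arc h" and eq: "path_image g = path_image h"
  shows "g ` {0<..<1} \<subseteq> h ` {0<..<1}"
proof -
  obtain k where k: "homeomorphism {0..1} (path_image h) h k"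
    using homeomorphism_arc[OF h] by blast
  let ?f = "k \<circ> g"
  have gim: "g ` {0..1} = path_image h"
    using eq by (simp add: path_image_def)
  have cont: "continuous_on {0..1} ?f"
    using g k gim unfolding arc_def path_def homeomorphism_def
    by (intro continuous_on_compose) auto
  have "inj_on k (path_image h)"
    using k unfolding homeomorphism_def by (metis inj_on_inverseI)
  then have inj: "inj_on ?f {0..1}"
    using g gim unfolding arc_def by (intro comp_inj_on) auto
  have "open (?f ` {0<..<1})"
    using injective_eq_1d_open_map_UNIV[OF cont] inj
    by (metis greaterThanLessThan_subseteq_atLeastAtMost_iff is_interval_cc open_greaterThanLessThan order_refl)
  moreover have sub: "?f ` {0<..<1} \<subseteq> {0..1}"
  proof -
    have "k ` path_image h = {0..1}" using k unfolding homeomorphism_def by blast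
    then show ?thesis using gim by (force simp: image_comp[symmetric])
  qed
  ultimately have "?f ` {0<..<1} \<subseteq> interior {0..1}"
    by (rule interior_maximal[rotated])
  then have *: "?f ` {0<..<1} \<subseteq> {0<..<1}" by simp
  have "h (k (g t)) = g t" if "t \<in> {0<..<1}" for t
  proof -
    have "g t \<in> path_image h" using gim that by auto
    then show ?thesis using k unfolding homeomorphism_def by blast
  qed
  then show ?thesis using * by (force simp: image_iff)
qed

lemma string_interior_eq:
  assumes "arc g"
  shows "string_interior (path_image g) = g ` {0<..<1}"
  unfolding string_interior_def using assms arc_interior_subset by blast

definition contact_system :: "(real^2) set set \<Rightarrow> bool" where
  "contact_system S \<longleftrightarrow> finite S \<and> (\<forall>s\<in>S. is_string s) \<and>
     pairwise (\<lambda>s t. disjnt (string_interior s) (string_interior t)) S"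

text \<open>Since \<open>card\<close> of an infinite set is \<open>0\<close>, \<open>touching\<close> is meaningful only for finite \<open>S\<close>, which
  \<open>contact_system\<close> guarantees; \<open>one_intersecting\<close> asks for finite intersections explicitly.\<close>

definition touching :: "nat \<Rightarrow> (real^2) set set \<Rightarrow> bool" where
  "touching k S \<longleftrightarrow> (\<forall>p. card {s \<in> S. p \<in> s} \<le> k)"

definition one_intersecting :: "(real^2) set set \<Rightarrow> bool" where
  "one_intersecting S \<longleftrightarrow> pairwise (\<lambda>s t. finite (s \<inter> t) \<and> card (s \<inter> t) \<le> 1) S"

text \<open>A simple graph is a pair of a vertex set and a set of two-element vertex sets.\<close>

type_synonym 'v graph = "'v set \<times> 'v set set"

definition intersection_graph :: "'a set set \<Rightarrow> 'a set graph" where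
  "intersection_graph S = (S, {{s, t} | s t. s \<in> S \<and> t \<in> S \<and> s \<noteq> t \<and> s \<inter> t \<noteq> {}})"

definition proper_coloring :: "'v graph \<Rightarrow> ('v \<Rightarrow> 'c) \<Rightarrow> bool" where
  "proper_coloring G c \<longleftrightarrow> (\<forall>u\<in>fst G. \<forall>v\<in>fst G. {u, v} \<in> snd G \<longrightarrow> c u \<noteq> c v)"

definition colorable :: "'v graph \<Rightarrow> nat \<Rightarrow> bool" where
  "colorable G n \<longleftrightarrow> (\<exists>c :: 'v \<Rightarrow> nat. proper_coloring G c \<and> c ` fst G \<subseteq> {..<n})"

end

theory Submission
  imports Defs
begin

text \<open>
  Any subset of a contact system satisfies the same hypotheses, so by greedy coloring it is enough
  to find, in every nonempty system, a string with fewer than \<open>D = \<lceil>4k/3\<rceil> + 6\<close> neighbours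
  (\<open>contact_system_few_neighbours\<close>).  Suppose that every string has at least \<open>D\<close>.  Writing \<open>m(p)\<close>
  for the number of strings through \<open>p\<close>, a string has at most the sum of \<open>m(p) - 1\<close> over its
  contact points as neighbours.

  Every contact in the interior of a string consists of ends of other strings, and there are only
  two ends per string.  For \<open>k \<le> 8\<close> this alone suffices: on average a string has at most two
  neighbours through its interior, and at most \<open>2 (k - 1)\<close> through its ends, while \<open>D > 2k\<close>.

  For \<open>k \<ge> 9\<close> call a contact point big if at least 8 strings pass through it.  Cut each string at the
  big points on it; the pieces between consecutive big points are the edges of a plane graph with the
  big points as vertices, and this graph is simple because two strings meet at most once.  So
  it has at most three times as many edges as vertices.  As each big point is on at least 8 strings, this
  leaves on average at least one string per big point that has the big point as an end and contains
  no other.  Such a string gets at most \<open>k - 1\<close> neighbours at its big end and at most 6 at the other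
  end, and since \<open>D \<ge> k + 9\<close>, at least 4 ends of other strings lie at small points in its interior.
  It offers only one small end itself, so at least 3 ends must come from elsewhere.  The only strings that
  can offer more small ends than they use are those with a big point in their interior; they
  offer at most two ends each, and there is at most one of them per big point.  As \<open>2 < 3\<close>, there are no
  big points at all (\<open>big_points_impossible\<close>).  And without big points the count used for small \<open>k\<close>
  works, with \<open>2 \<cdot> 6\<close> in place of \<open>2 (k - 1)\<close>.

  The edge bound for plane graphs (\<open>card_edges_plane_graph\<close>) comes from Euler's formula, proved here
  for drawings with arbitrary arcs by inserting the edges one by one.  An edge that joins two
  connected vertices closes a Jordan curve and splits one face into exactly two; any other edge
  leaves the number of faces unchanged.  Both statements rest on Janiszewski's theorem:
  two points separated neither by \<open>A\<close> nor by \<open>B\<close> are not separated by \<open>A \<union> B\<close> if \<open>A \<inter> B\<close> is connected.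
  It also shows that two edges never separate the plane, so that every face has at least three edges.
\<close>

section \<open>Adding an edge to a compact subset of the plane\<close>

lemma in_componentsI:
  assumes "C \<noteq> {}" "C \<subseteq> S" "connected C"
    and "\<And>D. C \<subseteq> D \<Longrightarrow> D \<subseteq> S \<Longrightarrow> connected D \<Longrightarrow> D = C"
  shows "C \<in> components S"
  using assms unfolding in_components_maximal by simp

lemma in_components_maximalD:
  assumes "C \<in> components S" "C \<subseteq> D" "D \<subseteq> S" "connected D"
  shows "D = C"
  using assms in_components_nonempty[OF assms(1)] unfolding in_components_maximal by blast

lemma frontier_component_Compl_subset:
  fixes K :: "'a::real_normed_vector set"
  assumes "closed K" "C \<in> components (- K)"
  shows "frontier C \<subseteq> K"
proof
  fix x assume x: "x \<in> frontier C"
  have "open C" using assms open_Compl open_components by blast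
  then have "x \<notin> C" using x by (simp add: frontier_def interior_open)
  show "x \<in> K"
  proof (rule ccontr)
    assume "x \<notin> K"
    let ?D = "connected_component_set (- K) x"
    have D: "?D \<in> components (- K)" using \<open>x \<notin> K\<close> by (simp add: componentsI)
    have "open ?D" using D assms open_Compl open_components by blast
    moreover have "x \<in> ?D" using \<open>x \<notin> K\<close> by simp
    moreover have "x \<in> closure C" using x by (simp add: frontier_def)
    ultimately have "?D \<inter> C \<noteq> {}" using open_Int_closure_eq_empty by blast
    then have "?D = C" using D assms(2) components_eq by blast
    then show False using \<open>x \<in> ?D\<close> \<open>x \<notin> C\<close> by simp
  qed
qed

text \<open>A connected set that leaves \<open>C\<close> meets the frontier of \<open>C\<close>.  So a face of \<open>K\<close> is determined by the part
of \<open>K\<close> on its boundary; this is what forces a face to have many boundary edges.\<close>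

lemma component_Compl_of_frontier_subset:
  fixes T K C :: "'a::real_normed_vector set"
  assumes C: "C \<in> components (- K)" and "T \<subseteq> K" and fr: "frontier C \<subseteq> T"
  shows "C \<in> components (- T)"
proof -
  have "C \<noteq> {}" "C \<subseteq> - K" "connected C" using C in_components_nonempty in_components_subset in_components_connected by blast+
  moreover have "D = C" if D: "C \<subseteq> D" "D \<subseteq> - T" "connected D" for D
  proof (rule ccontr)
    assume "D \<noteq> C"
    then have "D - C \<noteq> {}" "D \<inter> C \<noteq> {}" using D \<open>C \<noteq> {}\<close> by auto
    then have "D \<inter> frontier C \<noteq> {}" using connected_Int_frontier D(3) by blast
    then show False using fr D by blast
  qed
  ultimately show ?thesis using \<open>T \<subseteq> K\<close> by (intro in_componentsI) blast+
qed

text \<open>The new edge \<open>e\<close> runs inside the single face \<open>U\<close>, so only \<open>U\<close> is affected.  The next lemmas count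
the components of \<open>U - e\<close>.\<close>

lemma components_Compl_insert_edge:
  fixes K L U :: "'a::topological_space set"
  assumes U: "U \<in> components (- L)" and eU: "e - L \<subseteq> U"
  shows "components (- (L \<union> e)) = (components (- L) - {U}) \<union> components (U - e)"
proof (intro set_eqI iffI)
  have Um: "D \<subseteq> U" if "connected D" "D \<subseteq> - L" "D \<inter> U \<noteq> {}" for D
    using components_maximal[OF U] that by blast
  have UL: "U \<subseteq> - L" using U in_components_subset by blast
  fix C
  {
    assume C: "C \<in> components (- (L \<union> e))"
    then have Cc: "connected C" "C \<subseteq> - (L \<union> e)" "C \<noteq> {}"
      using in_components_nonempty in_components_subset in_components_connected by blast+
    then obtain D where D: "D \<in> components (- L)" "C \<subseteq> D"
      using exists_component_superset[of C "- L"] by blast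
    show "C \<in> (components (- L) - {U}) \<union> components (U - e)"
    proof (cases "D = U")
      case True
      then have "C \<in> components (U - e)"
        using components_intermediate_subset[OF C, of "U - e"] D Cc UL by blast
      then show ?thesis by blast
    next
      case False
      then have "D \<inter> U = {}" using components_nonoverlap[OF D(1) U] by blast
      then have "D \<subseteq> - (L \<union> e)" using in_components_subset[OF D(1)] eU by blast
      moreover have "connected D" "D \<noteq> {}" using D in_components_nonempty in_components_connected by blast+
      ultimately have "D = C" using in_components_maximalD[OF C D(2)] by blast
      then show ?thesis using D False by blast
    qed
  next
    assume "C \<in> (components (- L) - {U}) \<union> components (U - e)"
    then show "C \<in> components (- (L \<union> e))"
    proof
      assume C: "C \<in> components (- L) - {U}"
      then have "C \<inter> U = {}" using components_nonoverlap[of C "- L" U] U by blast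
      then have "C \<subseteq> - (L \<union> e)" using C in_components_subset[of C "- L"] eU by blast
      then show ?thesis using components_intermediate_subset[of C "- L" "- (L \<union> e)"] C by blast
    next
      assume C: "C \<in> components (U - e)"
      then have Cc: "connected C" "C \<subseteq> U - e" "C \<noteq> {}"
        using in_components_nonempty in_components_subset in_components_connected by blast+
      have "D = C" if D: "C \<subseteq> D" "D \<subseteq> - (L \<union> e)" "connected D" for D
      proof -
        have "D \<subseteq> U" using Um D Cc by blast
        then have "D \<subseteq> U - e" using D by blast
        then show ?thesis using in_components_maximalD[OF C D(1)] D(3) by blast
      qed
      then show ?thesis using Cc UL by (intro in_componentsI) blast+
    qed
  }
qed

lemma open_edge_in_one_face:
  assumes g: "arc g" and int: "path_image g \<inter> L = {pathstart g, pathfinish g}"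
  obtains U where "U \<in> components (- L)" "path_image g - L \<subseteq> U" "path_image g - L \<noteq> {}"
proof -
  have *: "path_image g - L = path_image g - {pathstart g, pathfinish g}" using int by auto
  have "connected (path_image g - L)" "path_image g - L \<noteq> {}"
    unfolding * using arc_imp_simple_path[OF g]
    by (rule connected_simple_path_endless nonempty_simple_path_endless)+
  then show ?thesis using that exists_component_superset[of "path_image g - L" "- L"] by blast
qed

text \<open>Together with an arc \<open>d\<close> of \<open>L\<close> the edge forms a Jordan curve \<open>J\<close>, and \<open>U\<close> minus the edge is the union of
the parts of \<open>U\<close> on either side of \<open>J\<close>.  Both are nonempty because every point of \<open>J\<close> is on the
frontier of both sides.  Each part is connected by Janiszewski's theorem: two of its points are
separated neither by \<open>J\<close> nor by \<open>L\<close>, and \<open>J \<inter> L = d\<close> is connected.\<close>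

lemma cycle_edge_splits_face:
  fixes g :: "real \<Rightarrow> complex"
  assumes g: "arc g" and L: "compact L" and U: "U \<in> components (- L)" and gU: "path_image g - L \<subseteq> U"
    and int: "path_image g \<inter> L = {pathstart g, pathfinish g}"
    and joined: "path_component L (pathstart g) (pathfinish g)"
  shows "finite (components (U - path_image g)) \<and> card (components (U - path_image g)) = 2"
proof -
  let ?e = "path_image g"
  let ?P = "path_component_set L (pathstart g)"
  have UL: "U \<subseteq> - L" and conU: "connected U" using U in_components_subset in_components_connected by blast+
  have opU: "open U" using open_components[OF open_Compl[OF compact_imp_closed[OF L]] U] .
  have "pathstart g \<noteq> pathfinish g" using arc_distinct_ends[OF g] by metis
  moreover have "pathstart g \<in> ?P" "pathfinish g \<in> ?P"
    using joined path_component_mem(1)[OF joined] by (auto simp: path_component_refl)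
  ultimately obtain d where d: "arc d" "path_image d \<subseteq> ?P" "pathstart d = pathfinish g" "pathfinish d = pathstart g"
    using path_connected_path_component[of L "pathstart g"] unfolding path_connected_arcwise by metis
  have dL: "path_image d \<subseteq> L" using d(2) path_component_subset by blast
  let ?J = "?e \<union> path_image d"
  have J: "path_image (g +++ d) = ?J" using d by (simp add: path_image_join)
  have sp: "simple_path (g +++ d)"
    by (rule simple_path_join_loop) (use g d dL int in auto)
  have loop: "pathfinish (g +++ d) = pathstart (g +++ d)" using d by simp
  obtain A B where AB: "A \<noteq> {}" "open A" "connected A" "B \<noteq> {}" "open B" "connected B"
     "A \<inter> B = {}" "A \<union> B = - ?J" "frontier A = ?J" "frontier B = ?J"
    using Jordan_curve[OF sp loop] unfolding J by metis
  have cJ: "compact ?J" using g d by (simp add: arc_imp_path compact_path_image compact_Un)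
  obtain x where x: "x \<in> ?e" "x \<in> U"
    using open_edge_in_one_face[OF g int] gU by blast
  have "pathstart g \<in> path_image d" "pathfinish g \<in> path_image d"
    using pathfinish_in_path_image[of d] pathstart_in_path_image[of d] unfolding d(3,4) by blast+
  then have "?e \<inter> L \<subseteq> path_image d" unfolding int by simp
  then have JL: "?J \<inter> L = path_image d" using dL by auto
  have part: "U \<inter> X \<noteq> {} \<and> open (U \<inter> X) \<and> connected (U \<inter> X)"
    if X: "open X" "connected X" "X \<subseteq> - ?J" "frontier X = ?J" for X
  proof (intro conjI)
    have "x \<in> closure X" using x X(4) by (auto simp: frontier_def)
    then show "U \<inter> X \<noteq> {}" using x opU open_Int_closure_eq_empty by blast
    show "open (U \<inter> X)" using opU X by blast
    show "connected (U \<inter> X)"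
      unfolding connected_iff_connected_component
    proof (intro ballI)
      fix p q assume pq: "p \<in> U \<inter> X" "q \<in> U \<inter> X"
      have "connected_component (- ?J) p q" using connected_componentI[OF X(2,3)] pq by blast
      moreover have "connected_component (- L) p q" using connected_componentI[OF conU UL] pq by blast
      moreover have "connected (?J \<inter> L)" unfolding JL using connected_arc_image[OF d(1)] .
      ultimately have "connected_component (- (?J \<union> L)) p q"
        by (intro Janiszewski[OF cJ compact_imp_closed[OF L]])
      then obtain T where T: "connected T" "T \<subseteq> - (?J \<union> L)" "p \<in> T" "q \<in> T"
        unfolding connected_component_def by blast
      have "T \<subseteq> U" using components_maximal[OF U T(1)] T pq by blast
      moreover have "T \<subseteq> X"
      proof (rule ccontr)
        assume "\<not> T \<subseteq> X"
        then have "T \<inter> frontier X \<noteq> {}" using connected_Int_frontier[OF T(1), of X] T(3) pq by blast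
        then show False using X T by blast
      qed
      ultimately show "connected_component (U \<inter> X) p q" using connected_componentI[OF T(1)] T(3,4) by simp
    qed
  qed
  have Ue: "U - ?e = (U \<inter> A) \<union> (U \<inter> B)"
    using AB(8) UL dL by blast
  have pA: "U \<inter> A \<noteq> {}" "open (U \<inter> A)" "connected (U \<inter> A)" using part[of A] AB by blast+
  have pB: "U \<inter> B \<noteq> {}" "open (U \<inter> B)" "connected (U \<inter> B)" using part[of B] AB by blast+
  have disj: "(U \<inter> A) \<inter> (U \<inter> B) = {}" using AB by blast
  have "components (\<Union>{U \<inter> A, U \<inter> B}) = {U \<inter> A, U \<inter> B}"
    by (rule components_open_unique) (use pA pB disj in \<open>auto simp: pairwise_def disjnt_def\<close>)
  then have "components (U - ?e) = {U \<inter> A, U \<inter> B}" unfolding Ue by simp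
  moreover have "U \<inter> A \<noteq> U \<inter> B" using disj pA(1) by (metis Int_absorb)
  ultimately show ?thesis by (metis card_2_iff finite.emptyI finite.insertI)
qed

text \<open>The set \<open>L \<union> e\<close> is built up from \<open>L1\<close>, \<open>e\<close> and \<open>L2\<close>, where each new set meets the union of the previous
ones in a single point, so Janiszewski's theorem applies twice.  The edge cannot fill \<open>U\<close>, since
then the frontier of \<open>U\<close> would consist of the two ends of the edge, and two points do not separate
the plane.\<close>

lemma bridge_keeps_face:
  fixes g :: "real \<Rightarrow> complex"
  assumes g: "arc g" and L: "L = L1 \<union> L2" "compact L1" "compact L2" "L1 \<inter> L2 = {}"
    and U: "U \<in> components (- L)" and gU: "path_image g - L \<subseteq> U"
    and int: "path_image g \<inter> L = {pathstart g, pathfinish g}"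
    and sep: "pathstart g \<in> L1" "pathfinish g \<in> L2"
  shows "components (U - path_image g) = {U - path_image g}"
proof -
  let ?e = "path_image g"
  have cL: "compact L" using L by blast
  have UL: "U \<subseteq> - L" and conU: "connected U" using U in_components_subset in_components_connected by blast+
  have opU: "open U" using open_components[OF open_Compl[OF compact_imp_closed[OF cL]] U] .
  have ce: "compact ?e" using g by (simp add: arc_imp_path compact_path_image)
  have "connected (U - ?e)"
    unfolding connected_iff_connected_component
  proof (intro ballI)
    fix p q assume pq: "p \<in> U - ?e" "q \<in> U - ?e"
    have "connected_component (- L) p q" using connected_componentI[OF conU UL] pq by blast
    then have c1: "connected_component (- L1) p q" and c2: "connected_component (- L2) p q"
      using connected_component_of_subset[of "- L" p q] L(1) by blast+
    have "connected (- ?e)" using connected_arc_complement[OF g] by simp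
    then have ce': "connected_component (- ?e) p q" using pq by (simp add: connected_iff_connected_component)
    have "L1 \<inter> ?e = {pathstart g}" using int sep L by auto
    then have "connected_component (- (L1 \<union> ?e)) p q"
      using Janiszewski[OF L(2) compact_imp_closed[OF ce] _ c1 ce'] by simp
    moreover have "(L1 \<union> ?e) \<inter> L2 = {pathfinish g}" using int sep L by auto
    ultimately have "connected_component (- ((L1 \<union> ?e) \<union> L2)) p q"
      using Janiszewski[OF compact_Un[OF L(2) ce] compact_imp_closed[OF L(3)] _ _ c2] by simp
    then obtain T where T: "connected T" "T \<subseteq> - (L \<union> ?e)" "p \<in> T" "q \<in> T"
      unfolding connected_component_def L(1) by blast
    have "T \<subseteq> U" using components_maximal[OF U T(1)] T pq by blast
    then have "T \<subseteq> U - ?e" using T(2) by blast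
    then show "connected_component (U - ?e) p q" using connected_componentI[OF T(1)] T(3,4) by simp
  qed
  moreover have "U - ?e \<noteq> {}"
  proof
    assume "U - ?e = {}"
    then have "U \<subseteq> ?e" by blast
    then have "closure U \<subseteq> ?e" using ce by (simp add: closure_minimal compact_imp_closed)
    moreover have "frontier U \<subseteq> L"
      using frontier_component_Compl_subset[OF compact_imp_closed[OF cL] U] .
    ultimately have fr: "frontier U \<subseteq> {pathstart g, pathfinish g}"
      using int by (auto simp: frontier_def)
    have "connected (- {pathstart g, pathfinish g})"
      using connected_open_delete_finite[OF open_UNIV connected_UNIV, of "{pathstart g, pathfinish g}"]
      by (simp add: Compl_eq_Diff_UNIV)
    moreover have "- {pathstart g, pathfinish g} \<inter> U \<noteq> {}"
    proof -
      have "{pathstart g, pathfinish g} \<subseteq> L" unfolding int[symmetric] by simp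
      moreover have "U \<noteq> {}" using U in_components_nonempty by blast
      ultimately show ?thesis using UL by blast
    qed
    moreover have "- {pathstart g, pathfinish g} - U \<noteq> {}"
    proof
      assume "- {pathstart g, pathfinish g} - U = {}"
      moreover have "{pathstart g, pathfinish g} \<subseteq> ?e" using int by blast
      ultimately have "UNIV = ?e" using \<open>U \<subseteq> ?e\<close> by blast
      then show False using ce not_compact_UNIV by metis
    qed
    ultimately show False using connected_Int_frontier fr by blast
  qed
  ultimately show ?thesis by (simp add: components_eq_sing_iff)
qed

section \<open>Euler's formula for plane graphs\<close>

text \<open>Edges are indexed arcs, so parallel edges are possible; simplicity is assumed only for the edge bound.\<close>

locale plane_graph =
  fixes V :: "complex set" and I :: "'i set" and \<gamma> :: "'i \<Rightarrow> real \<Rightarrow> complex"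
  assumes finite_V: "finite V" and finite_I: "finite I"
    and arc: "i \<in> I \<Longrightarrow> arc (\<gamma> i)"
    and ends: "i \<in> I \<Longrightarrow> path_image (\<gamma> i) \<inter> V = {pathstart (\<gamma> i), pathfinish (\<gamma> i)}"
    and no_cross: "i \<in> I \<Longrightarrow> j \<in> I \<Longrightarrow> i \<noteq> j \<Longrightarrow> path_image (\<gamma> i) \<inter> path_image (\<gamma> j) \<subseteq> V"

lemma (in plane_graph) ends_in_V:
  assumes "i \<in> I"
  shows "pathstart (\<gamma> i) \<in> V" "pathfinish (\<gamma> i) \<in> V"
proof -
  have "{pathstart (\<gamma> i), pathfinish (\<gamma> i)} \<subseteq> V" unfolding ends[OF assms, symmetric] by simp
  then show "pathstart (\<gamma> i) \<in> V" "pathfinish (\<gamma> i) \<in> V" by auto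
qed

lemma plane_graph_subset: "plane_graph V I \<gamma> \<Longrightarrow> J \<subseteq> I \<Longrightarrow> plane_graph V J \<gamma>"
  unfolding plane_graph_def by (metis finite_subset subsetD)

definition drawing :: "complex set \<Rightarrow> 'i set \<Rightarrow> ('i \<Rightarrow> real \<Rightarrow> complex) \<Rightarrow> complex set" where
  "drawing V I \<gamma> = V \<union> (\<Union>i\<in>I. path_image (\<gamma> i))"

lemma drawing_insert: "drawing V (insert i I) \<gamma> = drawing V I \<gamma> \<union> path_image (\<gamma> i)"
  by (auto simp: drawing_def)

lemma compact_drawing: "plane_graph V I \<gamma> \<Longrightarrow> compact (drawing V I \<gamma>)"
  unfolding drawing_def plane_graph_def
  by (intro compact_Un compact_UN) (auto simp: finite_imp_compact arc_imp_path compact_path_image)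

lemma new_edge_meets_drawing:
  assumes "plane_graph V (insert i I) \<gamma>" "i \<notin> I"
  shows "path_image (\<gamma> i) \<inter> drawing V I \<gamma> = {pathstart (\<gamma> i), pathfinish (\<gamma> i)}"
proof -
  interpret plane_graph V "insert i I" \<gamma> by fact
  have "path_image (\<gamma> i) \<inter> path_image (\<gamma> j) \<subseteq> V" if "j \<in> I" for j
    using no_cross[of i j] that \<open>i \<notin> I\<close> by blast
  then have "path_image (\<gamma> i) \<inter> drawing V I \<gamma> = path_image (\<gamma> i) \<inter> V"
    unfolding drawing_def by blast
  then show ?thesis using ends by simp
qed

text \<open>If the labels are constant along edges, the drawing of the vertices and edges with the label of \<open>u\<close>
and the drawing of all the others are disjoint, since edges meet only in vertices.\<close>

lemma separated_ends_in_disjoint_parts: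
  assumes "plane_graph V I \<gamma>"
    and lab: "\<And>j. j \<in> I \<Longrightarrow> lab (pathstart (\<gamma> j)) = lab (pathfinish (\<gamma> j))"
    and uv: "u \<in> V" "v \<in> V" "lab u \<noteq> lab v"
  obtains L1 L2 where "drawing V I \<gamma> = L1 \<union> L2" "compact L1" "compact L2" "L1 \<inter> L2 = {}" "u \<in> L1" "v \<in> L2"
proof -
  interpret plane_graph V I \<gamma> by fact
  define part where "part P = drawing {x \<in> V. P (lab x)} {j \<in> I. P (lab (pathstart (\<gamma> j)))} \<gamma>"
    for P :: "'b \<Rightarrow> bool"
  have labV: "lab x = lab (pathstart (\<gamma> j))" if "j \<in> I" "x \<in> V" "x \<in> path_image (\<gamma> j)" for x j
  proof -
    have "x \<in> {pathstart (\<gamma> j), pathfinish (\<gamma> j)}"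
      unfolding ends[OF that(1), symmetric] using that by simp
    then show ?thesis using lab[OF that(1)] by auto
  qed
  have cp: "compact (part P)" for P
    unfolding part_def drawing_def using finite_V finite_I arc
    by (intro compact_Un compact_UN) (auto simp: finite_imp_compact arc_imp_path compact_path_image)
  let ?P = "\<lambda>l. l = lab u"
  have "drawing V I \<gamma> = part ?P \<union> part (\<lambda>l. \<not> ?P l)"
    unfolding part_def drawing_def by auto
  moreover have "part ?P \<inter> part (\<lambda>l. \<not> ?P l) = {}"
  proof -
    have "\<not> (x \<in> part ?P \<and> x \<in> part (\<lambda>l. \<not> ?P l))" for x
    proof
      assume x: "x \<in> part ?P \<and> x \<in> part (\<lambda>l. \<not> ?P l)"
      have "x \<in> V"
      proof (rule ccontr)
        assume "x \<notin> V"
        with x obtain i j where "i \<in> I" "j \<in> I" "i \<noteq> j" "x \<in> path_image (\<gamma> i)" "x \<in> path_image (\<gamma> j)"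
          unfolding part_def drawing_def by blast
        then show False using no_cross[of i j] \<open>x \<notin> V\<close> by blast
      qed
      have "P (lab x)" if "x \<in> part P" for P
        using that labV[OF _ \<open>x \<in> V\<close>] unfolding part_def drawing_def by auto
      then show False using x by blast
    qed
    then show ?thesis by blast
  qed
  moreover have "u \<in> part ?P" "v \<in> part (\<lambda>l. \<not> ?P l)"
    unfolding part_def drawing_def using uv by auto
  ultimately show ?thesis using that cp by blast
qed

text \<open>The labelling \<open>lab\<close> names the connected components of the graph: its values on \<open>V\<close> are constant along
edges, and equal values mean that the vertices are joined inside the drawing.  Thus \<open>card (lab ` V)\<close>
is the number of components, and carrying \<open>lab\<close> through the induction decides which of
\<open>cycle_edge_splits_face\<close> and \<open>bridge_keeps_face\<close> applies to a new edge.\<close>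

theorem euler_formula:
  assumes "plane_graph V I \<gamma>"
  shows "\<exists>lab :: complex \<Rightarrow> complex.
     (\<forall>i\<in>I. lab (pathstart (\<gamma> i)) = lab (pathfinish (\<gamma> i)))
   \<and> (\<forall>x\<in>V. \<forall>y\<in>V. lab x = lab y \<longrightarrow> path_component (drawing V I \<gamma>) x y)
   \<and> finite (components (- drawing V I \<gamma>))
   \<and> card (components (- drawing V I \<gamma>)) + card V = 1 + card I + card (lab ` V)"
proof -
  have "finite I" using assms plane_graph.finite_I by blast
  then show ?thesis using assms
  proof (induction I rule: finite_induct)
    case empty
    then have "finite V" unfolding plane_graph_def by simp
    have "connected (- V)"
      using connected_open_delete_finite[OF open_UNIV connected_UNIV _ \<open>finite V\<close>]
      by (simp add: Compl_eq_Diff_UNIV)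
    moreover have "- V \<noteq> {}"
    proof
      assume "- V = {}"
      then have "V = UNIV" by blast
      then show False using \<open>finite V\<close> infinite_UNIV_char_0[where 'a=complex] by simp
    qed
    ultimately have "components (- drawing V {} \<gamma>) = {- V}"
      unfolding drawing_def by (simp add: components_eq_sing_iff)
    then show ?case by (intro exI[of _ id]) (auto simp: drawing_def path_component_refl)
  next
    case (insert i I)
    interpret plane_graph V "insert i I" \<gamma> by fact
    have PG: "plane_graph V I \<gamma>" using plane_graph_subset[OF insert.prems] by blast
    let ?L = "drawing V I \<gamma>" and ?e = "path_image (\<gamma> i)"
    let ?u = "pathstart (\<gamma> i)" and ?v = "pathfinish (\<gamma> i)"
    obtain lab :: "complex \<Rightarrow> complex" where
      lab: "\<And>j. j \<in> I \<Longrightarrow> lab (pathstart (\<gamma> j)) = lab (pathfinish (\<gamma> j))"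
      and conn: "\<And>x y. x \<in> V \<Longrightarrow> y \<in> V \<Longrightarrow> lab x = lab y \<Longrightarrow> path_component ?L x y"
      and fin: "finite (components (- ?L))"
      and count: "card (components (- ?L)) + card V = 1 + card I + card (lab ` V)"
      using insert.IH[OF PG] by metis
    have arci: "arc (\<gamma> i)" using arc by simp
    have uv: "?u \<in> V" "?v \<in> V" using ends_in_V by simp_all
    have int: "?e \<inter> ?L = {?u, ?v}" using new_edge_meets_drawing[OF insert.prems insert.hyps(2)] .
    obtain U where U: "U \<in> components (- ?L)" "?e - ?L \<subseteq> U"
      using open_edge_in_one_face[OF arci int] by metis
    have cL: "compact ?L" using compact_drawing[OF PG] .
    have draw: "drawing V (insert i I) \<gamma> = ?L \<union> ?e" by (rule drawing_insert)
    have comps: "components (- (?L \<union> ?e)) = (components (- ?L) - {U}) \<union> components (U - ?e)"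
      using components_Compl_insert_edge[OF U] .
    have dis: "(components (- ?L) - {U}) \<inter> components (U - ?e) = {}"
    proof -
      have False if "X \<in> components (- ?L) - {U}" "X \<in> components (U - ?e)" for X
      proof -
        have "X \<inter> U = {}" using components_nonoverlap[OF _ U(1), of X] that(1) by simp
        moreover have "X \<subseteq> U" "X \<noteq> {}" using in_components_subset[OF that(2)] in_components_nonempty[OF that(2)] by auto
        ultimately show False by blast
      qed
      then show ?thesis by blast
    qed
    have newcount: "card (components (- (?L \<union> ?e))) + 1 = card (components (- ?L)) + card (components (U - ?e))"
      if "finite (components (U - ?e))"
    proof -
      have "card (components (- ?L) - {U}) + 1 = card (components (- ?L))"
        using card_Suc_Diff1[OF fin U(1)] by simp
      then show ?thesis
        unfolding comps using card_Un_disjoint[OF _ that dis] fin by simp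
    qed
    have mono: "path_component (?L \<union> ?e) x y" if "path_component ?L x y" for x y
      using path_component_of_subset[OF _ that] by simp
    show ?case
    proof (cases "lab ?u = lab ?v")
      case True
      have n: "finite (components (U - ?e))" "card (components (U - ?e)) = 2"
        using cycle_edge_splits_face[OF arci cL U int conn[OF uv True]] by simp_all
      show ?thesis unfolding draw
      proof (intro exI[of _ lab] conjI)
        show "finite (components (- (?L \<union> ?e)))" unfolding comps using fin n by simp
        show "card (components (- (?L \<union> ?e))) + card V = 1 + card (insert i I) + card (lab ` V)"
          using newcount n count insert.hyps by simp
        show "\<forall>j\<in>insert i I. lab (pathstart (\<gamma> j)) = lab (pathfinish (\<gamma> j))"
          using lab True by simp
        show "\<forall>x\<in>V. \<forall>y\<in>V. lab x = lab y \<longrightarrow> path_component (?L \<union> ?e) x y"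
          using conn mono by simp
      qed
    next
      case False
      obtain L1 L2 where L12: "?L = L1 \<union> L2" "compact L1" "compact L2" "L1 \<inter> L2 = {}" "?u \<in> L1" "?v \<in> L2"
        using separated_ends_in_disjoint_parts[OF PG lab uv False] by metis
      have n: "components (U - ?e) = {U - ?e}"
        using bridge_keeps_face[OF arci L12(1-4) U int L12(5,6)] .
      \<comment> \<open>The component of the second end takes over the label of the first.\<close>
      define lab' where "lab' x = (if lab x = lab ?v then lab ?u else lab x)" for x
      have "lab' ` V = lab ` V - {lab ?v}"
        unfolding lab'_def using uv False by (auto simp: image_iff)
      then have cardlab: "card (lab' ` V) + 1 = card (lab ` V)"
        using uv finite_V card_Suc_Diff1[of "lab ` V" "lab ?v"] by simp
      have uv_conn: "path_component (?L \<union> ?e) ?u ?v"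
        unfolding path_component_def
        by (intro exI[of _ "\<gamma> i"]) (simp add: arc_imp_path[OF arci])
      have to_u: "path_component (?L \<union> ?e) ?u x" if "x \<in> V" "lab' x = lab' ?u" for x
      proof (cases "lab x = lab ?v")
        case True
        then show ?thesis using path_component_trans[OF uv_conn mono[OF conn]] \<open>x \<in> V\<close> uv by simp
      next
        case F: False
        then have "lab ?u = lab x" using that(2) False unfolding lab'_def by simp
          then show ?thesis using mono[OF conn] uv that(1) by simp
      qed
      show ?thesis unfolding draw
      proof (intro exI[of _ lab'] conjI ballI impI)
        show "lab' (pathstart (\<gamma> j)) = lab' (pathfinish (\<gamma> j))" if "j \<in> insert i I" for j
          using that lab unfolding lab'_def by auto
        show "path_component (?L \<union> ?e) x y" if "x \<in> V" "y \<in> V" "lab' x = lab' y" for x y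
        proof (cases "lab x = lab y")
          case True
          then show ?thesis using mono[OF conn] that by simp
        next
          case F: False
          then have "lab' x = lab' ?u" using that False unfolding lab'_def by (auto split: if_splits)
          then show ?thesis
            using path_component_trans[OF path_component_sym[OF to_u[of x]] to_u[of y]] that by simp
        qed
        show "finite (components (- (?L \<union> ?e)))" unfolding comps using fin n by simp
        show "card (components (- (?L \<union> ?e))) + card V = 1 + card (insert i I) + card (lab' ` V)"
          using newcount n count insert.hyps cardlab by simp
      qed
    qed
  qed
qed

section \<open>The edge bound for simple plane graphs\<close>

text \<open>The faces incident with an edge are those that disappear when the edge is deleted: they are the
components of what the edge leaves of a single face.\<close>

lemma card_faces_at_edge_le_2:
  assumes PG: "plane_graph V (insert i I) \<gamma>" and "i \<notin> I"
  shows "card (components (- drawing V (insert i I) \<gamma>) - components (- drawing V I \<gamma>)) \<le> 2"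
proof -
  interpret plane_graph V "insert i I" \<gamma> by fact
  have PG': "plane_graph V I \<gamma>" using plane_graph_subset[OF PG] by blast
  let ?L = "drawing V I \<gamma>" and ?e = "path_image (\<gamma> i)"
  let ?u = "pathstart (\<gamma> i)" and ?v = "pathfinish (\<gamma> i)"
  obtain lab :: "complex \<Rightarrow> complex" where
    lab: "\<And>j. j \<in> I \<Longrightarrow> lab (pathstart (\<gamma> j)) = lab (pathfinish (\<gamma> j))"
    and conn: "\<And>x y. x \<in> V \<Longrightarrow> y \<in> V \<Longrightarrow> lab x = lab y \<Longrightarrow> path_component ?L x y"
    using euler_formula[OF PG'] by metis
  have arci: "arc (\<gamma> i)" using arc by simp
  have uv: "?u \<in> V" "?v \<in> V" using ends_in_V by simp_all
  have int: "?e \<inter> ?L = {?u, ?v}" using new_edge_meets_drawing[OF PG \<open>i \<notin> I\<close>] .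
  obtain U where U: "U \<in> components (- ?L)" "?e - ?L \<subseteq> U"
    using open_edge_in_one_face[OF arci int] by metis
  have n: "finite (components (U - ?e)) \<and> card (components (U - ?e)) \<le> 2"
  proof (cases "lab ?u = lab ?v")
    case True
    then show ?thesis
      using cycle_edge_splits_face[OF arci compact_drawing[OF PG'] U int conn[OF uv True]] by simp
  next
    case False
    obtain L1 L2 where L12: "?L = L1 \<union> L2" "compact L1" "compact L2" "L1 \<inter> L2 = {}" "?u \<in> L1" "?v \<in> L2"
      using separated_ends_in_disjoint_parts[OF PG' lab uv False] by metis
    then show ?thesis using bridge_keeps_face[OF arci L12(1-4) U int L12(5,6)] by simp
  qed
  have "components (- drawing V (insert i I) \<gamma>) - components (- ?L) \<subseteq> components (U - ?e)"
    unfolding drawing_insert components_Compl_insert_edge[OF U] by blast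
  then show ?thesis using n card_mono order_trans by metis
qed

lemma frontier_other_face_avoids_edge:
  assumes PG: "plane_graph V (insert i I) \<gamma>" and "i \<notin> I"
    and f: "f \<in> components (- drawing V (insert i I) \<gamma>)" "f \<in> components (- drawing V I \<gamma>)"
  shows "frontier f \<inter> path_image (\<gamma> i) \<subseteq> V"
proof
  interpret plane_graph V "insert i I" \<gamma> by fact
  fix x assume x: "x \<in> frontier f \<inter> path_image (\<gamma> i)"
  let ?L = "drawing V I \<gamma>" and ?e = "path_image (\<gamma> i)"
  have int: "?e \<inter> ?L = {pathstart (\<gamma> i), pathfinish (\<gamma> i)}"
    using new_edge_meets_drawing[OF PG \<open>i \<notin> I\<close>] .
  obtain U where U: "U \<in> components (- ?L)" "?e - ?L \<subseteq> U"
    using open_edge_in_one_face[OF arc int] by auto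
  have cL: "compact ?L" using compact_drawing[OF plane_graph_subset[OF PG]] by blast
  show "x \<in> V"
  proof (rule ccontr)
    assume "x \<notin> V"
    have "x \<notin> ?L"
    proof
      assume "x \<in> ?L"
      then have "x \<in> {pathstart (\<gamma> i), pathfinish (\<gamma> i)}" unfolding int[symmetric] using x by simp
      then show False using ends_in_V[of i] \<open>x \<notin> V\<close> by auto
    qed
    then have "x \<in> U" using x U(2) by blast
    have "x \<notin> f" using x in_components_subset[OF f(1)] unfolding drawing_insert by blast
    then have "f \<inter> U = {}" using components_nonoverlap[OF f(2) U(1)] \<open>x \<in> U\<close> by auto
    moreover have "open U" using open_components[OF open_Compl[OF compact_imp_closed[OF cL]] U(1)] .
    ultimately have "U \<inter> closure f = {}" using open_Int_closure_eq_empty[of U f] by blast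
    then show False using \<open>x \<in> U\<close> x by (auto simp: frontier_def)
  qed
qed

text \<open>Arcs do not separate the plane; nor do two arcs that share at most one point, by Janiszewski's
theorem; and removing finitely many further points keeps an open connected set connected.\<close>

lemma connected_Compl_drawing_two_edges:
  assumes PG: "plane_graph V J \<gamma>" and "card J \<le> 2"
    and simple: "\<And>i j x y. i \<in> J \<Longrightarrow> j \<in> J \<Longrightarrow> i \<noteq> j \<Longrightarrow>
        x \<in> path_image (\<gamma> i) \<inter> path_image (\<gamma> j) \<Longrightarrow> y \<in> path_image (\<gamma> i) \<inter> path_image (\<gamma> j) \<Longrightarrow> x = y"
  shows "connected (- drawing V J \<gamma>)"
proof -
  interpret plane_graph V J \<gamma> by fact
  let ?E = "\<Union>i\<in>J. path_image (\<gamma> i)"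
  have c1: "connected (- path_image (\<gamma> i))" if "i \<in> J" for i
    using connected_arc_complement[OF arc[OF that]] by simp
  have k1: "compact (path_image (\<gamma> i))" if "i \<in> J" for i
    using arc[OF that] by (simp add: arc_imp_path compact_path_image)
  have "connected (- ?E)"
  proof -
    consider "J = {}" | i where "J = {i}" | i j where "i \<noteq> j" "J = {i, j}"
      using \<open>card J \<le> 2\<close> finite_I by (metis One_nat_def card_0_eq card_1_singletonE card_2_iff le_Suc_eq le_zero_eq numeral_2_eq_2)
    then show ?thesis
    proof cases
      case 3
      have "connected (path_image (\<gamma> i) \<inter> path_image (\<gamma> j))"
      proof (cases "path_image (\<gamma> i) \<inter> path_image (\<gamma> j) = {}")
        case False
        then obtain x where x: "x \<in> path_image (\<gamma> i) \<inter> path_image (\<gamma> j)" by blast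
        have "y = x" if "y \<in> path_image (\<gamma> i) \<inter> path_image (\<gamma> j)" for y
          using simple[of i j y x] that x 3 by simp
        then have "path_image (\<gamma> i) \<inter> path_image (\<gamma> j) = {x}" using x by blast
        then show ?thesis by simp
      qed simp
      then show ?thesis
        using Janiszewski_connected[OF k1 compact_imp_closed[OF k1] _ c1 c1, of i j] 3 by simp
    qed (use c1 in auto)
  qed
  moreover have "open (- ?E)" using finite_I k1 by (intro open_Compl closed_UN) (auto simp: compact_imp_closed)
  ultimately have "connected (- ?E - V)"
    using connected_open_delete_finite[OF _ _ _ finite_V] by simp
  moreover have "- drawing V J \<gamma> = - ?E - V" unfolding drawing_def by blast
  ultimately show ?thesis by simp
qed

text \<open>Count incidences between faces and edges: an edge has at most two faces, and a face has at least
three edges.  For if a face \<open>f\<close> had at most two, the drawing of these edges would contain the frontier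
of \<open>f\<close> without separating the plane, so \<open>f\<close> would be its whole complement and there would be no
third edge.  This gives \<open>3F \<le> 2E\<close>, which turns Euler's formula into \<open>E \<le> 3V - 6\<close>.\<close>

theorem card_edges_plane_graph:
  assumes PG: "plane_graph V I \<gamma>" and "card I \<ge> 3"
    and simple: "\<And>i j x y. i \<in> I \<Longrightarrow> j \<in> I \<Longrightarrow> i \<noteq> j \<Longrightarrow>
        x \<in> path_image (\<gamma> i) \<inter> path_image (\<gamma> j) \<Longrightarrow> y \<in> path_image (\<gamma> i) \<inter> path_image (\<gamma> j) \<Longrightarrow> x = y"
  shows "card I + 6 \<le> 3 * card V"
proof -
  interpret plane_graph V I \<gamma> by fact
  let ?D = "drawing V I \<gamma>"
  let ?F = "components (- ?D)"
  define R where "R f i \<longleftrightarrow> f \<notin> components (- drawing V (I - {i}) \<gamma>)" for f i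
  obtain lab :: "complex \<Rightarrow> complex" where fin: "finite ?F"
      and count: "card ?F + card V = 1 + card I + card (lab ` V)"
    using euler_formula[OF PG] by metis
  have "I \<noteq> {}" using \<open>card I \<ge> 3\<close> by auto
  then have "V \<noteq> {}" using ends_in_V by blast
  then have "card (lab ` V) \<ge> 1" using finite_V by (simp add: Suc_leI card_gt_0_iff)
  have edge: "card {f \<in> ?F. R f i} \<le> 2" if "i \<in> I" for i
  proof -
    have "insert i (I - {i}) = I" using that by blast
    then have "card (?F - components (- drawing V (I - {i}) \<gamma>)) \<le> 2"
      using card_faces_at_edge_le_2[of V i "I - {i}" \<gamma>] PG by simp
    moreover have "{f \<in> ?F. R f i} = ?F - components (- drawing V (I - {i}) \<gamma>)"
      unfolding R_def by blast
    ultimately show ?thesis by simp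
  qed
  have face: "card {i \<in> I. R f i} \<ge> 3" if f: "f \<in> ?F" for f
  proof (rule ccontr)
    assume "\<not> 3 \<le> card {i \<in> I. R f i}"
    define J where "J = {i \<in> I. R f i}"
    have J: "J \<subseteq> I" "card J \<le> 2" using \<open>\<not> 3 \<le> _\<close> unfolding J_def by auto
    have PGJ: "plane_graph V J \<gamma>" using plane_graph_subset[OF PG J(1)] .
    have cD: "closed ?D" using compact_imp_closed[OF compact_drawing[OF PG]] .
    have "frontier f \<subseteq> drawing V J \<gamma>"
    proof
      fix x assume x: "x \<in> frontier f"
      show "x \<in> drawing V J \<gamma>"
      proof (rule ccontr)
        assume nx: "x \<notin> drawing V J \<gamma>"
        have "x \<in> ?D" using frontier_component_Compl_subset[OF cD f] x by blast
        then obtain i where i: "i \<in> I" "x \<in> path_image (\<gamma> i)" "i \<notin> J" "x \<notin> V"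
          using nx unfolding drawing_def by blast
        then have "f \<in> components (- drawing V (I - {i}) \<gamma>)" unfolding J_def R_def by simp
        then have "frontier f \<inter> path_image (\<gamma> i) \<subseteq> V"
          using frontier_other_face_avoids_edge[of V i "I - {i}" \<gamma> f] PG f insert_Diff[OF i(1)] by simp
        then show False using x i by blast
      qed
    qed
    moreover have "drawing V J \<gamma> \<subseteq> ?D" using J unfolding drawing_def by blast
    ultimately have "f \<in> components (- drawing V J \<gamma>)"
      using component_Compl_of_frontier_subset[OF f] by blast
    moreover have "connected (- drawing V J \<gamma>)"
      by (rule connected_Compl_drawing_two_edges[OF PGJ J(2)]) (use simple J(1) in blast)
    ultimately have "f = - drawing V J \<gamma>"
      by (metis components_empty components_eq_sing_iff empty_iff singletonD)
    then have DJ: "?D \<subseteq> drawing V J \<gamma>" using in_components_subset[OF f] by blast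
    have "I \<subseteq> J"
    proof
      fix i assume i: "i \<in> I"
      obtain x where x: "x \<in> path_image (\<gamma> i)" "x \<notin> V"
        using nonempty_simple_path_endless[OF arc_imp_simple_path[OF arc[OF i]]] ends[OF i] by blast
      then have "x \<in> drawing V J \<gamma>" using DJ i unfolding drawing_def by blast
      then obtain j where "j \<in> J" "x \<in> path_image (\<gamma> j)" using x unfolding drawing_def by blast
      then show "i \<in> J" using no_cross[of i j] i x J by blast
    qed
    then show False using J \<open>card I \<ge> 3\<close> by auto
  qed
  have "3 * card ?F = (\<Sum>f\<in>?F. 3)" by simp
  also have "\<dots> \<le> (\<Sum>f\<in>?F. card {i \<in> I. R f i})" using face by (intro sum_mono)
  also have "\<dots> = (\<Sum>i\<in>I. card {f \<in> ?F. R f i})"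
    by (rule sum_multicount_gen) (use fin finite_I in auto)
  also have "\<dots> \<le> (\<Sum>i\<in>I. 2)" using edge by (intro sum_mono)
  finally have "3 * card ?F \<le> 2 * card I" by simp
  then show ?thesis using count \<open>card (lab ` V) \<ge> 1\<close> by linarith
qed

section \<open>The plane graph on the big points\<close>

text \<open>The strings are moved to the complex plane, where the Jordan curve theorem and Janiszewski's theorem
are stated.\<close>

definition plane_iso :: "real^2 \<Rightarrow> complex" where
  "plane_iso v = Complex (v $ 1) (v $ 2)"

lemma linear_plane_iso: "linear plane_iso"
  by (rule linearI) (auto simp: plane_iso_def complex_eq_iff)

lemma inj_plane_iso: "inj plane_iso"
  by (auto simp: inj_def plane_iso_def vec_eq_iff forall_2)

locale contact_strings =
  fixes S :: "(real^2) set set" and G :: "(real^2) set \<Rightarrow> real \<Rightarrow> real^2"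
  assumes finite_S: "finite S"
    and arcG: "s \<in> S \<Longrightarrow> arc (G s)" and imG: "s \<in> S \<Longrightarrow> path_image (G s) = s"
    and disj: "s \<in> S \<Longrightarrow> t \<in> S \<Longrightarrow> s \<noteq> t \<Longrightarrow> G s ` {0<..<1} \<inter> G t ` {0<..<1} = {}"
    and one: "s \<in> S \<Longrightarrow> t \<in> S \<Longrightarrow> s \<noteq> t \<Longrightarrow> finite (s \<inter> t) \<and> card (s \<inter> t) \<le> 1"
begin

lemma injG: "s \<in> S \<Longrightarrow> x \<in> {0..1} \<Longrightarrow> y \<in> {0..1} \<Longrightarrow> G s x = G s y \<Longrightarrow> x = y"
  using arcG[of s] by (simp add: arc_def inj_on_def)

lemma in_string_iff: "s \<in> S \<Longrightarrow> p \<in> s \<longleftrightarrow> (\<exists>x\<in>{0..1}. p = G s x)"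
  using imG[of s] by (auto simp: path_image_def)

lemma meet_once:
  assumes "s \<in> S" "t \<in> S" "s \<noteq> t" "p \<in> s" "p \<in> t" "q \<in> s" "q \<in> t"
  shows "p = q"
proof -
  have "finite (s \<inter> t)" "card (s \<inter> t) \<le> Suc 0" using one[OF assms(1-3)] by auto
  then show ?thesis using card_le_Suc0_iff_eq[of "s \<inter> t"] assms by blast
qed

context
  fixes B :: "(real^2) set"
  assumes finB: "finite B"
begin

text \<open>The parameters at which a string passes through a point of \<open>B\<close>.  In the following, a piece of the
string \<open>s\<close> is the part from one such parameter \<open>x\<close> to the next one.\<close>

definition times :: "(real^2) set \<Rightarrow> real set" where
  "times s = {x \<in> {0..1}. G s x \<in> B}"

definition next_time :: "(real^2) set \<Rightarrow> real \<Rightarrow> real" where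
  "next_time s x = Min {y \<in> times s. x < y}"

definition pieces :: "((real^2) set \<times> real) set" where
  "pieces = Sigma S (\<lambda>s. times s - {Max (times s)})"

definition piece :: "(real^2) set \<times> real \<Rightarrow> real \<Rightarrow> complex" where
  "piece = (\<lambda>(s, x). plane_iso \<circ> subpath x (next_time s x) (G s))"

lemma times_bij:
  assumes "s \<in> S" shows "bij_betw (G s) (times s) (s \<inter> B)"
  unfolding bij_betw_def
proof
  show "inj_on (G s) (times s)" using injG[OF assms] unfolding times_def inj_on_def by blast
  have "G s ` times s = G s ` {0..1} \<inter> B" unfolding times_def by auto
  then show "G s ` times s = s \<inter> B" using imG[OF assms] unfolding path_image_def by simp
qed

lemma finite_times: "s \<in> S \<Longrightarrow> finite (times s)"
  using times_bij bij_betw_finite finB by blast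

lemma card_pieces: "card pieces = (\<Sum>s\<in>S. card (s \<inter> B) - 1)"
proof -
  have "card (times s - {Max (times s)}) = card (s \<inter> B) - 1" if "s \<in> S" for s
  proof (cases "times s = {}")
    case True
    then show ?thesis using bij_betw_same_card[OF times_bij[OF that]] by simp
  next
    case False
    then have "Max (times s) \<in> times s" using finite_times[OF that] by simp
    then show ?thesis
      using bij_betw_same_card[OF times_bij[OF that]] finite_times[OF that] by (simp add: card_Diff_singleton)
  qed
  then show ?thesis unfolding pieces_def using finite_S finite_times by (subst card_SigmaI) auto
qed

lemma next_time_props:
  assumes "(s, x) \<in> pieces"
  shows "s \<in> S" "x \<in> times s" "next_time s x \<in> times s" "x < next_time s x"
    "\<And>y. y \<in> times s \<Longrightarrow> x < y \<Longrightarrow> next_time s x \<le> y"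
    "0 \<le> x" "next_time s x \<le> 1"
proof -
  show s: "s \<in> S" and x: "x \<in> times s" using assms unfolding pieces_def by auto
  have fin: "finite {y \<in> times s. x < y}" using finite_times[OF s] by simp
  have "x \<noteq> Max (times s)" using assms unfolding pieces_def by auto
  moreover have "x \<le> Max (times s)" "Max (times s) \<in> times s"
    using Max_ge[OF finite_times[OF s] x] Max_in[OF finite_times[OF s]] x by auto
  ultimately have "Max (times s) \<in> {y \<in> times s. x < y}" by simp
  then have "next_time s x \<in> {y \<in> times s. x < y}"
    unfolding next_time_def by (intro Min_in fin) blast
  then show n: "next_time s x \<in> times s" "x < next_time s x" by auto
  show "next_time s x \<le> y" if "y \<in> times s" "x < y" for y
    unfolding next_time_def using fin that by simp
  show "0 \<le> x" using x unfolding times_def by simp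
  show "next_time s x \<le> 1" using n(1) unfolding times_def by simp
qed

lemma image_piece:
  assumes "(s, x) \<in> pieces"
  shows "path_image (piece (s, x)) = plane_iso ` (G s ` {x..next_time s x})"
  using next_time_props(4)[OF assms] unfolding piece_def
  by (simp add: path_image_compose path_image_subpath)

lemma ends_piece: "pathstart (piece (s, x)) = plane_iso (G s x)" "pathfinish (piece (s, x)) = plane_iso (G s (next_time s x))"
  by (simp_all add: piece_def pathstart_compose pathfinish_compose)

lemma piece_point:
  assumes sx: "(s, x) \<in> pieces" and p: "plane_iso p \<in> path_image (piece (s, x))"
  obtains r where "p = G s r" "x \<le> r" "r \<le> next_time s x" "0 \<le> r" "r \<le> 1" "p \<in> s"
proof -
  obtain r where r: "plane_iso p = plane_iso (G s r)" "x \<le> r" "r \<le> next_time s x"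
    using p unfolding image_piece[OF sx] by auto
  have pr: "p = G s r" using r(1) inj_plane_iso by (simp add: inj_def)
  have r01: "0 \<le> r" "r \<le> 1" using r next_time_props(6,7)[OF sx] by auto
  have "p \<in> s" using in_string_iff[OF next_time_props(1)[OF sx], of p] pr r01 by auto
  then show ?thesis using that[OF pr r(2,3) r01] by simp
qed

lemma pieces_meet_same:
  assumes "(s, x) \<in> pieces" "(s, y) \<in> pieces" "x < y"
    and "plane_iso p \<in> path_image (piece (s, x))" "plane_iso p \<in> path_image (piece (s, y))"
  shows "p = G s y"
proof -
  have s: "s \<in> S" using next_time_props(1)[OF assms(1)] .
  obtain r where r: "p = G s r" "r \<le> next_time s x" "0 \<le> r" "r \<le> 1"
    using piece_point[OF assms(1,4)] by metis
  obtain r' where r': "p = G s r'" "y \<le> r'" "0 \<le> r'" "r' \<le> 1"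
    using piece_point[OF assms(2,5)] by metis
  have "r = r'" using injG[OF s] r r' by simp
  moreover have "next_time s x \<le> y"
    using next_time_props(5)[OF assms(1)] next_time_props(2)[OF assms(2)] assms(3) by simp
  ultimately have "r = y" using r(2) r'(2) by linarith
  then show ?thesis using r(1) by simp
qed

text \<open>The two ends of a piece are in \<open>B\<close>, so a point outside \<open>B\<close> lies strictly between them.\<close>

lemma piece_interior_point:
  assumes sx: "(s, x) \<in> pieces" and p: "plane_iso p \<in> path_image (piece (s, x))" and "p \<notin> B"
  shows "p \<in> G s ` {0<..<1}"
proof -
  obtain r where r: "p = G s r" "x \<le> r" "r \<le> next_time s x"
    using piece_point[OF sx p] by metis
  have "G s x \<in> B" "G s (next_time s x) \<in> B"
    using next_time_props(2,3)[OF sx] unfolding times_def by auto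
  then have "r \<noteq> x" "r \<noteq> next_time s x" using r \<open>p \<notin> B\<close> by auto
  then have "0 < r" "r < 1" using r next_time_props(6,7)[OF sx] by auto
  then show ?thesis using r by simp
qed

text \<open>Pieces of different strings share at most one point because the strings do.  That point is in \<open>B\<close>,
as otherwise it would be in the interior of both strings.  Pieces of the same string share at most
the end of one piece that is the start of the next.\<close>

lemma pieces_meet_once:
  assumes "i \<in> pieces" "j \<in> pieces" "i \<noteq> j"
    and p: "plane_iso p \<in> path_image (piece i)" "plane_iso p \<in> path_image (piece j)"
    and q: "plane_iso q \<in> path_image (piece i)" "plane_iso q \<in> path_image (piece j)"
  shows "p = q" and "p \<in> B"
proof -
  obtain s x t y where ij: "i = (s, x)" "j = (t, y)" by (metis surj_pair)
  note sx = assms(1)[unfolded ij] and ty = assms(2)[unfolded ij]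
  have st: "s \<in> S" "t \<in> S" using next_time_props(1)[OF sx] next_time_props(1)[OF ty] by auto
  have "p = q \<and> p \<in> B"
  proof (cases "s = t")
    case False
    have mem: "z \<in> s \<and> z \<in> t" if "plane_iso z \<in> path_image (piece i)" "plane_iso z \<in> path_image (piece j)" for z
      using piece_point[OF sx, of z] piece_point[OF ty, of z] that unfolding ij by metis
    have "p \<in> B"
    proof (rule ccontr)
      assume "p \<notin> B"
      then have "p \<in> G s ` {0<..<1}" "p \<in> G t ` {0<..<1}"
        using piece_interior_point[OF sx] piece_interior_point[OF ty] p unfolding ij by auto
      then show False using disj[OF st False] by blast
    qed
    then show ?thesis using meet_once[OF st False] mem[OF p] mem[OF q] by simp
  next
    case True
    then have "x < y \<or> y < x" using assms(3) unfolding ij by auto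
    moreover have "G s y \<in> B" "G s x \<in> B"
      using next_time_props(2)[OF sx] next_time_props(2)[OF ty] True unfolding times_def by auto
    ultimately show ?thesis
      using pieces_meet_same[of s x y p] pieces_meet_same[of s x y q]
        pieces_meet_same[of s y x p] pieces_meet_same[of s y x q] p q sx ty unfolding ij True by auto
  qed
  then show "p = q" "p \<in> B" by auto
qed

lemma path_image_piece_subset: "i \<in> pieces \<Longrightarrow> z \<in> path_image (piece i) \<Longrightarrow> \<exists>p. z = plane_iso p"
  by (cases i) (auto simp: image_piece)

lemma plane_graph_pieces: "plane_graph (plane_iso ` B) pieces piece"
proof
  show "finite (plane_iso ` B)" using finB by simp
  show "finite pieces" unfolding pieces_def using finite_S finite_times by (intro finite_SigmaI) auto
  fix i assume i: "i \<in> pieces"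
  obtain s x where ix: "i = (s, x)" by (metis surj_pair)
  note sx = i[unfolded ix]
  have n: "x \<in> {0..1}" "next_time s x \<in> {0..1}" "x \<noteq> next_time s x"
    using next_time_props(4,6,7)[OF sx] by auto
  show "arc (piece i)"
    unfolding ix piece_def using arc_subpath_arc[OF arcG n] next_time_props(1)[OF sx]
      arc_linear_image_eq[OF linear_plane_iso inj_plane_iso] by simp
  show "path_image (piece i) \<inter> plane_iso ` B = {pathstart (piece i), pathfinish (piece i)}"
  proof (intro equalityI subsetI)
    fix z assume "z \<in> path_image (piece i) \<inter> plane_iso ` B"
    then obtain p where p: "z = plane_iso p" "p \<in> B" "plane_iso p \<in> path_image (piece (s, x))"
      unfolding ix by auto
    obtain r where r: "p = G s r" "x \<le> r" "r \<le> next_time s x" "0 \<le> r" "r \<le> 1"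
      using piece_point[OF sx p(3)] by metis
    have "r \<in> times s" using r p unfolding times_def by simp
    then have "x < r \<Longrightarrow> next_time s x \<le> r" using next_time_props(5)[OF sx, of r] by simp
    then have "r = x \<or> r = next_time s x" using r(2,3) by (cases "x < r") (simp_all add: order_antisym)
    then show "z \<in> {pathstart (piece i), pathfinish (piece i)}"
      unfolding ix ends_piece using r p by auto
  next
    fix z assume "z \<in> {pathstart (piece i), pathfinish (piece i)}"
    moreover have "G s x \<in> B" "G s (next_time s x) \<in> B"
      using next_time_props(2,3)[OF sx] unfolding times_def by auto
    ultimately show "z \<in> path_image (piece i) \<inter> plane_iso ` B"
      unfolding ix using pathstart_in_path_image[of "piece (s, x)"] pathfinish_in_path_image[of "piece (s, x)"]
      unfolding ends_piece by auto
  qed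
  fix j assume j: "j \<in> pieces" "i \<noteq> j"
  show "path_image (piece i) \<inter> path_image (piece j) \<subseteq> plane_iso ` B"
  proof
    fix z assume z: "z \<in> path_image (piece i) \<inter> path_image (piece j)"
    then obtain p where "z = plane_iso p" using path_image_piece_subset i by blast
    then show "z \<in> plane_iso ` B" using pieces_meet_once(2)[OF i j, of p p] z by simp
  qed
qed

text \<open>A string with \<open>b\<close> points in \<open>B\<close> has \<open>b - 1\<close> pieces, where the truncated subtraction gives the right
value for \<open>b = 0\<close>.  The bound \<open>3V\<close> instead of \<open>3V - 6\<close> also covers graphs with fewer than three edges.\<close>

lemma sum_big_points_le: "(\<Sum>s\<in>S. card (s \<inter> B) - 1) \<le> 3 * card B"
proof -
  have cardB: "card (plane_iso ` B) = card B"
    by (rule card_image) (use inj_plane_iso in \<open>simp add: inj_on_def\<close>)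
  consider "card pieces \<ge> 3" | "pieces = {}" | "card pieces \<le> 2" "pieces \<noteq> {}" by linarith
  then have "card pieces \<le> 3 * card B"
  proof cases
    case 1
    have "card pieces + 6 \<le> 3 * card (plane_iso ` B)"
    proof (rule card_edges_plane_graph[OF plane_graph_pieces 1])
      fix i j z w assume ij: "i \<in> pieces" "j \<in> pieces" "i \<noteq> j"
        and zw: "z \<in> path_image (piece i) \<inter> path_image (piece j)" "w \<in> path_image (piece i) \<inter> path_image (piece j)"
      obtain p where p: "z = plane_iso p" using path_image_piece_subset[OF ij(1), of z] zw(1) by blast
      obtain q where q: "w = plane_iso q" using path_image_piece_subset[OF ij(1), of w] zw(2) by blast
      show "z = w" using pieces_meet_once(1)[OF ij, of p q] zw unfolding p q by simp
    qed
    then show ?thesis using cardB by simp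
  next
    case 3
    then obtain s x where "(s, x) \<in> pieces" by auto
    then have "G s x \<in> B" using next_time_props(2) unfolding times_def by blast
    then have "card B \<ge> 1" using finB by (metis One_nat_def Suc_leI card_gt_0_iff empty_iff)
    then show ?thesis using 3 by linarith
  qed simp
  then show ?thesis using card_pieces by simp
qed

end

end

section \<open>Greedy coloring and the arithmetic of the count\<close>

text \<open>Remove a string with fewer than \<open>n\<close> neighbours, color the rest, and give the string a color that none
of its neighbours has.\<close>

lemma greedy_coloring:
  assumes "finite S"
    and "\<And>T. T \<subseteq> S \<Longrightarrow> T \<noteq> {} \<Longrightarrow> \<exists>s\<in>T. card {t \<in> T. t \<noteq> s \<and> s \<inter> t \<noteq> {}} < n"
  shows "\<exists>c :: 'a set \<Rightarrow> nat. (\<forall>s\<in>S. c s < n) \<and> (\<forall>s\<in>S. \<forall>t\<in>S. s \<noteq> t \<and> s \<inter> t \<noteq> {} \<longrightarrow> c s \<noteq> c t)"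
  using assms
proof (induction S rule: finite_psubset_induct)
  case (psubset S)
  show ?case
  proof (cases "S = {}")
    case False
    then obtain s where s: "s \<in> S" "card {t \<in> S. t \<noteq> s \<and> s \<inter> t \<noteq> {}} < n"
      using psubset.prems[of S] by blast
    let ?N = "{t \<in> S. t \<noteq> s \<and> s \<inter> t \<noteq> {}}"
    have "S - {s} \<subset> S" using s by blast
    then have "\<exists>c :: 'a set \<Rightarrow> nat. (\<forall>t\<in>S - {s}. c t < n) \<and>
        (\<forall>t\<in>S - {s}. \<forall>t'\<in>S - {s}. t \<noteq> t' \<and> t \<inter> t' \<noteq> {} \<longrightarrow> c t \<noteq> c t')"
      by (rule psubset.IH) (rule psubset.prems, auto)
    then obtain c :: "'a set \<Rightarrow> nat" where c0: "(\<forall>t\<in>S - {s}. c t < n) \<and>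
        (\<forall>t\<in>S - {s}. \<forall>t'\<in>S - {s}. t \<noteq> t' \<and> t \<inter> t' \<noteq> {} \<longrightarrow> c t \<noteq> c t')"
      by (rule exE)
    note c = conjunct1[OF c0] conjunct2[OF c0]
    have "card (c ` ?N) < n"
      using card_image_le[of ?N c] s(2) psubset.hyps by simp
    then have "\<not> {..<n} \<subseteq> c ` ?N"
      using card_mono[of "c ` ?N" "{..<n}"] psubset.hyps by auto
    then obtain m where m: "m < n" "m \<notin> c ` ?N" by blast
    show ?thesis
    proof (intro exI[of _ "c(s := m)"] conjI ballI impI)
      show "(c(s := m)) t < n" if "t \<in> S" for t using c(1) m(1) that by simp
      show "(c(s := m)) t \<noteq> (c(s := m)) t'" if "t \<in> S" "t' \<in> S" "t \<noteq> t' \<and> t \<inter> t' \<noteq> {}" for t t'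
      proof -
        consider "t = s" | "t' = s" | "t \<noteq> s" "t' \<noteq> s" by blast
        then show ?thesis
        proof cases
          case 1
          then have "t' \<in> ?N" using that by blast
          then show ?thesis using 1 m(2) that by auto
        next
          case 2
          then have "t \<in> ?N" using that by blast
          then show ?thesis using 2 m(2) that by auto
        next
          case 3
          then show ?thesis using c(2) that by simp
        qed
      qed
    qed
  qed simp
qed

lemma colorable_intersection_graph:
  assumes "finite S"
    and "\<And>T. T \<subseteq> S \<Longrightarrow> T \<noteq> {} \<Longrightarrow> \<exists>s\<in>T. card {t \<in> T. t \<noteq> s \<and> s \<inter> t \<noteq> {}} < n"
  shows "colorable (intersection_graph S) n"
proof -
  obtain c :: "'a set \<Rightarrow> nat" where c: "\<And>s. s \<in> S \<Longrightarrow> c s < n"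
    "\<And>s t. s \<in> S \<Longrightarrow> t \<in> S \<Longrightarrow> s \<noteq> t \<Longrightarrow> s \<inter> t \<noteq> {} \<Longrightarrow> c s \<noteq> c t"
    using greedy_coloring[OF assms] by metis
  have "u \<noteq> v \<and> u \<inter> v \<noteq> {}" if "{u, v} \<in> snd (intersection_graph S)" for u v
    using that unfolding intersection_graph_def by (auto simp: doubleton_eq_iff)
  moreover have "fst (intersection_graph S) = S" by (simp add: intersection_graph_def)
  ultimately have "proper_coloring (intersection_graph S) c"
    unfolding proper_coloring_def using c(2) by simp
  moreover have "c ` fst (intersection_graph S) \<subseteq> {..<n}"
    using c(1) \<open>fst (intersection_graph S) = S\<close> by auto
  ultimately show ?thesis unfolding colorable_def by (intro exI[of _ c] conjI)
qed

text \<open>In this and the next lemma the index \<open>s\<close> is a string, \<open>b s\<close> the number of its big points, \<open>a s\<close> that of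
its ends that are not big, \<open>i s\<close> that of its interior big points, and \<open>q s\<close> the number of neighbours
that end at a small point in the interior of \<open>s\<close>.  Small points are on fewer than \<open>t\<close>
strings, with \<open>t = 8\<close> in the next lemma.
Each of the neighbours counted by \<open>q\<close> uses up one of the ends counted by \<open>a\<close>.

Without big points every string has two small ends, through which it has at most \<open>2 (t - 2)\<close>
neighbours; if all strings had more than \<open>2 (t - 2) + 2\<close> neighbours, then \<open>q > a\<close> for each of them.\<close>

lemma degree_bound_no_big_points:
  fixes a b i q :: "'s \<Rightarrow> nat"
  assumes "finite S" "S \<noteq> {}"
    and split: "\<And>s. s \<in> S \<Longrightarrow> b s + a s = 2 + i s" and a2: "\<And>s. s \<in> S \<Longrightarrow> a s \<le> 2"
    and deg: "\<And>s. s \<in> S \<Longrightarrow> D \<le> b s * (k - 1) + a s * (t - 2) + q s"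
    and qa: "sum q S \<le> sum a S"
    and b0: "\<And>s. s \<in> S \<Longrightarrow> b s = 0"
  shows "D \<le> 2 * (t - 2) + 2"
proof (rule ccontr)
  assume D: "\<not> D \<le> 2 * (t - 2) + 2"
  have "a s < q s" if "s \<in> S" for s
  proof -
    have "a s = 2" using split[OF that] a2[OF that] b0[OF that] by simp
    then show ?thesis using deg[OF that] b0[OF that] D by simp
  qed
  then have "sum a S < sum q S" using assms(1,2) by (intro sum_strict_mono)
  then show False using qa by simp
qed

text \<open>The proof adds up the local inequality \<open>3 b + a \<le> q + 6 (b - 1) + 5 i\<close>.  In the sum, \<open>a\<close> cancels \<open>q\<close>, and
the coefficients of the other terms are chosen such that the assumptions leave
\<open>24 N \<le> 18 N + 5 N\<close>.  The coefficient 3 is what a string with one big end can afford: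
its other end is small, so \<open>q \<ge> D - (k - 1) - 6 \<ge> 4 = 3 + a\<close>.\<close>

lemma big_points_impossible:
  fixes a b i q :: "'s \<Rightarrow> nat"
  assumes split: "\<And>s. s \<in> S \<Longrightarrow> b s + a s = 2 + i s" and a2: "\<And>s. s \<in> S \<Longrightarrow> a s \<le> 2"
    and deg: "\<And>s. s \<in> S \<Longrightarrow> D \<le> b s * (k - 1) + a s * 6 + q s"
    and qa: "sum q S \<le> sum a S"
    and iN: "sum i S \<le> N" and bN: "8 * N \<le> sum b S" and planar: "(\<Sum>s\<in>S. b s - 1) \<le> 3 * N"
    and D: "k + 9 \<le> D" "18 \<le> D" and k: "k \<ge> 1"
  shows "N = 0"
proof -
  have "3 * b s + a s \<le> q s + 6 * (b s - 1) + 5 * i s" if s: "s \<in> S" for s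
  proof -
    consider "b s = 0" | "b s = 1" "i s = 0" | "b s = 1" "i s \<ge> 1" | "b s \<ge> 2" by linarith
    then show ?thesis
    proof cases
      case 1
      then have "a s = 2" using split[OF s] a2[OF s] by linarith
      then show ?thesis using 1 deg[OF s] D by simp
    next
      case 2
      then have "a s = 1" using split[OF s] by linarith
      then show ?thesis using 2 deg[OF s] D k by simp
    next
      case 3
      then show ?thesis using a2[OF s] by simp
    next
      case 4
      then show ?thesis using split[OF s] by linarith
    qed
  qed
  then have "(\<Sum>s\<in>S. 3 * b s + a s) \<le> (\<Sum>s\<in>S. q s + 6 * (b s - 1) + 5 * i s)" by (rule sum_mono)
  then have "3 * sum b S + sum a S \<le> sum q S + 6 * (\<Sum>s\<in>S. b s - 1) + 5 * sum i S"
    by (simp add: sum.distrib sum_distrib_left)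
  then show ?thesis using qa iN bN planar by linarith
qed

section \<open>Counting contacts\<close>

context contact_strings
begin

definition "inner" :: "(real^2) set \<Rightarrow> (real^2) set" where "inner s = G s ` {0<..<1}"
definition tips :: "(real^2) set \<Rightarrow> (real^2) set" where "tips s = {G s 0, G s 1}"
text \<open>This exceeds by one the number of neighbours that a string through \<open>p\<close> has at \<open>p\<close>.\<close>

definition mult :: "real^2 \<Rightarrow> nat" where "mult p = card {s \<in> S. p \<in> s}"
definition contacts :: "(real^2) set" where "contacts = {p. \<exists>s\<in>S. \<exists>t\<in>S. s \<noteq> t \<and> p \<in> s \<and> p \<in> t}"
definition tips_at :: "real^2 \<Rightarrow> nat" where "tips_at p = card {s \<in> S. p \<in> tips s}"

lemma string_split:
  assumes "s \<in> S" shows "s = tips s \<union> inner s" "tips s \<inter> inner s = {}" "card (tips s) = 2" "finite (tips s)"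
proof -
  have "{0..1::real} = {0, 1} \<union> {0<..<1}" by auto
  then have "G s ` {0..1} = tips s \<union> inner s" unfolding tips_def inner_def by auto
  then show "s = tips s \<union> inner s" using imG[OF assms] unfolding path_image_def by simp
  have "G s 0 \<noteq> G s r \<and> G s 1 \<noteq> G s r" if "r \<in> {0<..<1}" for r
    using injG[OF assms, of 0 r] injG[OF assms, of 1 r] that by auto
  then show "tips s \<inter> inner s = {}"
    unfolding tips_def inner_def by blast
  have "G s 0 \<noteq> G s 1" using injG[OF assms, of 0 1] by auto
  then show "card (tips s) = 2" "finite (tips s)" unfolding tips_def by auto
qed

lemma finite_contacts: "finite contacts"
proof -
  have "contacts = (\<Union>s\<in>S. \<Union>t\<in>S - {s}. s \<inter> t)" unfolding contacts_def by blast
  moreover have "finite (\<Union>s\<in>S. \<Union>t\<in>S - {s}. s \<inter> t)"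
    using one by (intro finite_UN_I finite_Diff finite_S) auto
  ultimately show ?thesis by simp
qed

text \<open>A point in the interior of a string is not in the interior of any other.\<close>

lemma mult_inner:
  assumes "s \<in> S" "p \<in> inner s"
  shows "mult p - 1 = tips_at p"
proof -
  have "p \<in> s" "p \<notin> tips s" using string_split[OF assms(1)] assms(2) by blast+
  have "p \<in> tips t" if t: "t \<in> S" "t \<noteq> s" "p \<in> t" for t
  proof -
    have "p \<notin> inner t" using disj[OF t(1) assms(1) t(2)] assms(2) unfolding inner_def by blast
    then show ?thesis using string_split(1)[OF t(1)] t(3) by blast
  qed
  moreover have "p \<in> t" if "t \<in> S" "p \<in> tips t" for t using string_split(1)[OF that(1)] that(2) by blast
  ultimately have "{t \<in> S. p \<in> t} = insert s {t \<in> S. p \<in> tips t}"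
    using \<open>p \<in> s\<close> assms(1) by blast
  then show ?thesis unfolding mult_def tips_at_def using \<open>p \<notin> tips s\<close> finite_S by simp
qed

lemma card_neighbours_le:
  assumes "s \<in> S"
  shows "card {t \<in> S. t \<noteq> s \<and> s \<inter> t \<noteq> {}} \<le> (\<Sum>p\<in>contacts \<inter> s. mult p - 1)"
proof -
  have "{t \<in> S. t \<noteq> s \<and> s \<inter> t \<noteq> {}} \<subseteq> (\<Union>p\<in>contacts \<inter> s. {t \<in> S. p \<in> t} - {s})"
    unfolding contacts_def using assms by blast
  then have "card {t \<in> S. t \<noteq> s \<and> s \<inter> t \<noteq> {}} \<le> card (\<Union>p\<in>contacts \<inter> s. {t \<in> S. p \<in> t} - {s})"
    by (intro card_mono) (use finite_S finite_contacts in auto)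
  also have "\<dots> \<le> (\<Sum>p\<in>contacts \<inter> s. card ({t \<in> S. p \<in> t} - {s}))"
    using finite_contacts by (intro card_UN_le) simp
  also have "\<dots> = (\<Sum>p\<in>contacts \<inter> s. mult p - 1)"
    unfolding mult_def by (rule sum.cong) (use assms finite_S in \<open>auto simp: card_Diff_singleton\<close>)
  finally show ?thesis .
qed

text \<open>An end of a string is in the interior of at most one other string, so it is counted at most once on
the left.\<close>

lemma sum_tips_at_inner_le:
  assumes "finite Q"
  shows "(\<Sum>s\<in>S. \<Sum>p\<in>Q \<inter> inner s. tips_at p) \<le> (\<Sum>s\<in>S. card (tips s \<inter> Q))"
proof -
  have inner_unique: "card {s \<in> S. p \<in> inner s} \<le> 1" for p
    using disj card_le_Suc0_iff_eq[of "{s \<in> S. p \<in> inner s}"] finite_S unfolding inner_def by fastforce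
  have "(\<Sum>s\<in>S. \<Sum>p\<in>Q \<inter> inner s. tips_at p) = (\<Sum>s\<in>S. \<Sum>p\<in>{p \<in> Q. p \<in> inner s}. tips_at p)"
    by (simp add: Int_def)
  also have "\<dots> = (\<Sum>p\<in>Q. \<Sum>s\<in>{s \<in> S. p \<in> inner s}. tips_at p)"
    by (rule sum.swap_restrict[OF finite_S assms])
  also have "\<dots> \<le> (\<Sum>p\<in>Q. tips_at p)"
  proof (rule sum_mono)
    fix p
    show "(\<Sum>s\<in>{s \<in> S. p \<in> inner s}. tips_at p) \<le> tips_at p"
      using mult_le_mono1[OF inner_unique[of p], of "tips_at p"] by simp
  qed
  also have "\<dots> = (\<Sum>s\<in>S. card {p \<in> Q. p \<in> tips s})"
    unfolding tips_at_def by (rule sum_multicount_gen) (use finite_S assms in auto)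
  also have "\<dots> = (\<Sum>s\<in>S. card (tips s \<inter> Q))" by (simp add: Int_def conj_commute)
  finally show ?thesis .
qed

lemma sum_inner_le:
  assumes "finite B"
  shows "(\<Sum>s\<in>S. card (inner s \<inter> B)) \<le> card B"
proof -
  have "(\<Sum>s\<in>S. card (inner s \<inter> B)) = card (\<Union>s\<in>S. inner s \<inter> B)"
    using disj by (subst card_UN_disjoint) (use finite_S assms in \<open>auto simp: inner_def\<close>)
  also have "\<dots> \<le> card B" using assms by (intro card_mono) auto
  finally show ?thesis .
qed

lemma sum_incidences: "finite B \<Longrightarrow> (\<Sum>s\<in>S. card (s \<inter> B)) = (\<Sum>p\<in>B. mult p)"
proof -
  assume "finite B"
  have "(\<Sum>s\<in>S. card (s \<inter> B)) = (\<Sum>s\<in>S. card {p \<in> B. p \<in> s})" by (simp add: Int_def conj_commute)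
  also have "\<dots> = (\<Sum>p\<in>B. mult p)"
    unfolding mult_def by (rule sum_multicount_gen) (use finite_S \<open>finite B\<close> in auto)
  finally show ?thesis .
qed

text \<open>The contact points of \<open>s\<close> are split into those in \<open>B\<close>, the ends of \<open>s\<close> outside \<open>B\<close>, and the interior
points outside \<open>B\<close>.\<close>

lemma card_neighbours_split:
  assumes s: "s \<in> S" and B: "B \<subseteq> contacts"
    and big: "\<And>p. mult p \<le> k" and small: "\<And>p. p \<in> contacts - B \<Longrightarrow> mult p < t"
  shows "card {u \<in> S. u \<noteq> s \<and> s \<inter> u \<noteq> {}}
     \<le> card (s \<inter> B) * (k - 1) + card (tips s - B) * (t - 2) + (\<Sum>p\<in>(contacts - B) \<inter> inner s. tips_at p)"
proof -
  let ?X = "s \<inter> B" and ?Y = "contacts \<inter> (tips s - B)" and ?Z = "(contacts - B) \<inter> inner s"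
  have fin: "finite ?X" "finite ?Y" "finite ?Z" using finite_contacts B finite_subset by auto
  have eq: "contacts \<inter> s = (?X \<union> ?Y) \<union> ?Z" using string_split(1)[OF s] B by blast
  have dis: "?X \<inter> ?Y = {}" "(?X \<union> ?Y) \<inter> ?Z = {}" using string_split(2)[OF s] by blast+
  have "(\<Sum>p\<in>?X. mult p - 1) \<le> card ?X * (k - 1)"
    using sum_bounded_above[of ?X "\<lambda>p. mult p - 1" "k - 1"] big by (simp add: diff_le_mono)
  moreover have "(\<Sum>p\<in>?Y. mult p - 1) \<le> card (tips s - B) * (t - 2)"
  proof -
    have "mult p - 1 \<le> t - 2" if "p \<in> ?Y" for p using small[of p] that by auto
    then have "(\<Sum>p\<in>?Y. mult p - 1) \<le> card ?Y * (t - 2)"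
      using sum_bounded_above[of ?Y "\<lambda>p. mult p - 1" "t - 2"] by simp
    also have "\<dots> \<le> card (tips s - B) * (t - 2)"
      using string_split(4)[OF s] by (intro mult_le_mono1 card_mono) auto
    finally show ?thesis .
  qed
  moreover have "(\<Sum>p\<in>?Z. mult p - 1) = (\<Sum>p\<in>?Z. tips_at p)"
    using mult_inner[OF s] by (intro sum.cong) auto
  moreover have "(\<Sum>p\<in>contacts \<inter> s. mult p - 1)
      = (\<Sum>p\<in>?X. mult p - 1) + (\<Sum>p\<in>?Y. mult p - 1) + (\<Sum>p\<in>?Z. mult p - 1)"
    unfolding eq using fin dis by (simp add: sum.union_disjoint)
  ultimately show ?thesis using card_neighbours_le[OF s] by linarith
qed

text \<open>The threshold \<open>t\<close> for big points is 8, where the planar count applies.  If \<open>D > 2k\<close> it is \<open>k + 1\<close> instead,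
which no point reaches, so there are no big points.\<close>

theorem exists_few_neighbours:
  assumes "S \<noteq> {}" and mk: "\<And>p. mult p \<le> k" and k: "k \<ge> 1" and D: "D > 2 * k \<or> (D \<ge> k + 9 \<and> D \<ge> 18)"
  shows "\<exists>s\<in>S. card {u \<in> S. u \<noteq> s \<and> s \<inter> u \<noteq> {}} < D"
proof (rule ccontr)
  assume "\<not> ?thesis"
  then have deg: "D \<le> card {u \<in> S. u \<noteq> s \<and> s \<inter> u \<noteq> {}}" if "s \<in> S" for s using that by force
  define t where "t = (if D > 2 * k then k + 1 else 8)"
  define B where "B = {p \<in> contacts. t \<le> mult p}"
  have finB: "finite B" and Bc: "B \<subseteq> contacts" unfolding B_def using finite_contacts by auto
  have small: "mult p < t" if "p \<in> contacts - B" for p using that unfolding B_def by auto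
  define b where "b s = card (s \<inter> B)" for s
  define a where "a s = card (tips s - B)" for s
  define i where "i s = card (inner s \<inter> B)" for s
  define q where "q s = (\<Sum>p\<in>(contacts - B) \<inter> inner s. tips_at p)" for s
  have 1: "b s + a s = 2 + i s" if s: "s \<in> S" for s
  proof -
    have "s \<inter> B = (tips s \<inter> B) \<union> (inner s \<inter> B)" using string_split(1)[OF s] by blast
    moreover have "(tips s \<inter> B) \<inter> (inner s \<inter> B) = {}" using string_split(2)[OF s] by blast
    ultimately have "b s = card (tips s \<inter> B) + i s"
      unfolding b_def i_def using finB by (metis card_Un_disjoint finite_Int)
    moreover have "card (tips s \<inter> B) + a s = card (tips s)"
      unfolding a_def using card_Int_Diff[OF string_split(4)[OF s], of B] by simp
    ultimately show ?thesis using string_split(3)[OF s] by simp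
  qed
  have 2: "a s \<le> 2" if "s \<in> S" for s
    unfolding a_def using card_mono[OF string_split(4)[OF that], of "tips s - B"] string_split(3)[OF that] by auto
  have 3: "D \<le> b s * (k - 1) + a s * (t - 2) + q s" if "s \<in> S" for s
    unfolding a_def b_def q_def
    by (rule order_trans[OF deg[OF that] card_neighbours_split[OF that Bc mk small]])
  have 4: "sum q S \<le> sum a S"
  proof -
    have "sum q S \<le> (\<Sum>s\<in>S. card (tips s \<inter> (contacts - B)))"
      unfolding q_def using sum_tips_at_inner_le[of "contacts - B"] finite_contacts by simp
    also have "\<dots> \<le> sum a S"
      unfolding a_def by (intro sum_mono card_mono) (use string_split(4) in auto)
    finally show ?thesis .
  qed
  have "card B = 0"
  proof (cases "D > 2 * k")
    case True
    then have "B = {}" unfolding B_def t_def using mk by (auto simp: not_less_eq_eq[symmetric] Suc_le_eq)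
    then show ?thesis by simp
  next
    case False
    then have t: "t = 8" unfolding t_def by simp
    have "card B * 8 \<le> (\<Sum>p\<in>B. mult p)"
      using sum_bounded_below[of B 8 mult] unfolding B_def t by simp
    then have "8 * card B \<le> sum b S" unfolding b_def sum_incidences[OF finB] by simp
    then show ?thesis
      using big_points_impossible[of S b a i D k q "card B"] 1 2 3 4 sum_inner_le[OF finB] sum_big_points_le[OF finB] False D k
      unfolding t b_def i_def by simp
  qed
  then have b0: "b s = 0" for s unfolding b_def using finB by simp
  have "D \<le> 2 * (t - 2) + 2"
    by (rule degree_bound_no_big_points[of S b a i D k t q]) (use finite_S assms(1) 1 2 3 4 b0 in auto)
  then show False using D k unfolding t_def by (auto split: if_splits)
qed

end

lemma contact_system_few_neighbours:
  assumes "contact_system S" "one_intersecting S" "touching k S" "S \<noteq> {}" "k \<ge> 1"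
    and D: "D > 2 * k \<or> (D \<ge> k + 9 \<and> D \<ge> 18)"
  shows "\<exists>s\<in>S. card {u \<in> S. u \<noteq> s \<and> s \<inter> u \<noteq> {}} < D"
proof -
  have "\<forall>s\<in>S. \<exists>g. arc g \<and> path_image g = s"
    using assms(1) unfolding contact_system_def is_string_def by blast
  then obtain G where G: "\<forall>s\<in>S. arc (G s) \<and> path_image (G s) = s" by metis
  have "string_interior s = G s ` {0<..<1}" if "s \<in> S" for s
    using string_interior_eq[of "G s"] G that by simp
  then interpret contact_strings S G
    using assms(1,2) G unfolding contact_system_def one_intersecting_def pairwise_def disjnt_def
    by unfold_locales auto
  show ?thesis
    using exists_few_neighbours[OF assms(4) _ assms(5) D] assms(3) unfolding touching_def mult_def by simp
qed

theorem theorem4p1: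
  fixes k :: nat and S :: "(real^2) set set"
  assumes "k \<ge> 3"
    and "contact_system S"
    and "one_intersecting S"
    and "touching k S"
  shows "colorable (intersection_graph S) (nat \<lceil>4 / 3 * real k\<rceil> + 6)"
proof (rule colorable_intersection_graph)
  show "finite S" using assms(2) unfolding contact_system_def by blast
  let ?D = "nat \<lceil>4 / 3 * real k\<rceil> + 6"
  have "4 / 3 * real k \<le> real_of_int \<lceil>4 / 3 * real k\<rceil>" by (rule le_of_int_ceiling)
  moreover have "0 \<le> \<lceil>4 / 3 * real k\<rceil>" by simp
  ultimately have "4 / 3 * real k \<le> real (nat \<lceil>4 / 3 * real k\<rceil>)" by simp
  then have "4 * k \<le> 3 * nat \<lceil>4 / 3 * real k\<rceil>" by linarith
  \<comment> \<open>The first alternative holds for \<open>k \<le> 8\<close>, the second one for \<open>k \<ge> 9\<close>.\<close>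
  then have D: "?D > 2 * k \<or> (?D \<ge> k + 9 \<and> ?D \<ge> 18)" by (cases "k \<le> 8") linarith+
  fix T assume T: "T \<subseteq> S" "T \<noteq> {}"
  have "contact_system T" "one_intersecting T"
    using assms(2,3) T finite_subset pairwise_subset
    unfolding contact_system_def one_intersecting_def by blast+
  moreover have "touching k T" unfolding touching_def
  proof
    fix p
    have "card {s \<in> T. p \<in> s} \<le> card {s \<in> S. p \<in> s}"
      using \<open>finite S\<close> T by (intro card_mono) auto
    then show "card {s \<in> T. p \<in> s} \<le> k" using assms(4) unfolding touching_def by (meson order_trans)
  qed
  ultimately show "\<exists>s\<in>T. card {t \<in> T. t \<noteq> s \<and> s \<inter> t \<noteq> {}} < ?D"
    using contact_system_few_neighbours[OF _ _ _ T(2) _ D] assms(1) by simp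
qed

end
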